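(* For any $p\in(1,\infty)$, the function $$G(\boldsymbol x)=\min_{\boldsymbol\xi:\|\boldsymbol\xi-\boldsymbol\xi^0\|_p\le\theta}\ \max_{k\in[K]}\{\boldsymbol\xi^\top\boldsymbol a_k(\boldsymbol x)+b_k(\boldsymbol x)\},\qquad\boldsymbol x\in\mathcal X,$$ with domain $\mathcal X$, may not be MICP-R; that is, for every $p\in(1,\infty)$ there exist data $(n,m,K,\mathcal X,\boldsymbol\xi^0,\theta,\{\boldsymbol a_k\},\{b_k\})$ as in the context for which $G$ is not MICP-R.
   Context: $[K]=\{1,\dots,K\}$. $\mathcal X\subseteq\mathbb R^n$ is a compact convex set with non-empty relative interior. For $k\in[K]$, $\boldsymbol a_k(\boldsymbol x)=\hat{\boldsymbol A}_k\boldsymbol x+\hat{\boldsymbol a}_k\in\mathbb R^m$ and $b_k(\boldsymbol x)=\hat{\boldsymbol B}_k^\top\boldsymbol x+\hat b_k\in\mathbb R$ are affine. $\boldsymbol\xi^0\in\mathbb R^m$, $\theta\ge0$. MICP-R (mixed-integer convex programming representable): a set $S\subseteq\mathbb R^n$ is MICP-R if there are integers $r,d$ and a closed convex set $M\subseteq\mathbb R^{n+r+d}$ such that $\boldsymbol x\in S$ if and only if there exist $\boldsymbol y\in\mathbb R^r$, $\boldsymbol z\in\mathbb Z^d$ with $(\boldsymbol x,\boldsymbol y,\boldsymbol z)\in M$. A function $f:S\to\mathbb R$ is MICP-R if both its domain $S$ and its epigraph $\{(\boldsymbol x,t):\boldsymbol x\in S,\ f(\boldsymbol x)\le t\}$ are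 MICP-R. *)

theory Defs
  imports "HOL-Analysis.Analysis" "HOL-Library.Function_Algebras"
begin

text \<open>
  The dimensions are quantified inside the statement, so R^n is represented as the set of those
  functions from \<^typ>\<open>nat\<close> to \<^typ>\<open>real\<close> that vanish from index n on; coordinates are numbered
  from 0. The pointwise vector space structure below makes the library notions \<^const>\<open>convex\<close>,
  \<^const>\<open>affine\<close> and \<^const>\<open>rel_interior\<close> available. The topology on the function type is
  the product topology; on R^n it induces the usual one (it is the one used for
  \<^const>\<open>Euclidean_space\<close>), and R^n is a closed subset, so that closedness and compactness of
  subsets of R^n have their usual meaning.
\<close>

instantiation "fun" :: (type, real_vector) real_vector
begin

definition scaleR_fun :: "real \<Rightarrow> ('a \<Rightarrow> 'b) \<Rightarrow> 'a \<Rightarrow> 'b"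
  where "scaleR_fun c f = (\<lambda>i. c *\<^sub>R f i)"

instance
  by standard
    (simp_all add: scaleR_fun_def fun_eq_iff scaleR_add_right scaleR_add_left)

end

definition Rn :: "nat \<Rightarrow> (nat \<Rightarrow> real) set"
  where "Rn n = {x. \<forall>i\<ge>n. x i = 0}"

lemma Rn_eq_Euclidean_space: "Rn n = topspace (Euclidean_space n)"
  by (simp add: Rn_def topspace_Euclidean_space)

definition Zn :: "nat \<Rightarrow> (nat \<Rightarrow> real) set"
  where "Zn d = {z \<in> Rn d. \<forall>i<d. z i \<in> \<int>}"

text \<open>The concatenation of x in R^n with y.\<close>

definition vappend :: "nat \<Rightarrow> (nat \<Rightarrow> real) \<Rightarrow> (nat \<Rightarrow> real) \<Rightarrow> nat \<Rightarrow> real"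
  where "vappend n x y = (\<lambda>i. if i < n then x i else y (i - n))"

definition MICP_R :: "nat \<Rightarrow> (nat \<Rightarrow> real) set \<Rightarrow> bool"
  where "MICP_R n S \<longleftrightarrow> S \<subseteq> Rn n \<and>
    (\<exists>r d M. M \<subseteq> Rn (n + r + d) \<and> closed M \<and> convex M \<and>
       (\<forall>x\<in>Rn n. x \<in> S \<longleftrightarrow> (\<exists>y\<in>Rn r. \<exists>z\<in>Zn d. vappend n x (vappend r y z) \<in> M)))"

text \<open>For x in R^n, the function \<^term>\<open>x(n := t)\<close> is the point (x, t) of R^(n+1).\<close>

definition epigraph_on :: "nat \<Rightarrow> (nat \<Rightarrow> real) set \<Rightarrow> ((nat \<Rightarrow> real) \<Rightarrow> real) \<Rightarrow> (nat \<Rightarrow> real) set"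
  where "epigraph_on n S f = {x(n := t) |x t. x \<in> S \<and> f x \<le> t}"

definition MICP_R_fun :: "nat \<Rightarrow> (nat \<Rightarrow> real) set \<Rightarrow> ((nat \<Rightarrow> real) \<Rightarrow> real) \<Rightarrow> bool"
  where "MICP_R_fun n S f \<longleftrightarrow> MICP_R n S \<and> MICP_R (n + 1) (epigraph_on n S f)"

definition dotp :: "nat \<Rightarrow> (nat \<Rightarrow> real) \<Rightarrow> (nat \<Rightarrow> real) \<Rightarrow> real"
  where "dotp n u v = (\<Sum>i<n. u i * v i)"

definition pnorm :: "nat \<Rightarrow> real \<Rightarrow> (nat \<Rightarrow> real) \<Rightarrow> real"
  where "pnorm m p \<xi> = (\<Sum>i<m. \<bar>\<xi> i\<bar> powr p) powr (1 / p)"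

definition pball :: "nat \<Rightarrow> real \<Rightarrow> (nat \<Rightarrow> real) \<Rightarrow> real \<Rightarrow> (nat \<Rightarrow> real) set"
  where "pball m p \<xi>0 \<theta> = {\<xi> \<in> Rn m. pnorm m p (\<xi> - \<xi>0) \<le> \<theta>}"

text \<open>
  An affine map is given by its matrix A, where \<^term>\<open>A i\<close> is the i-th row, and its offset a.
  Values of the data outside the relevant index ranges do not matter: \<^const>\<open>dotp\<close> ignores them.
\<close>

definition affmap :: "nat \<Rightarrow> (nat \<Rightarrow> nat \<Rightarrow> real) \<Rightarrow> (nat \<Rightarrow> real) \<Rightarrow> (nat \<Rightarrow> real) \<Rightarrow> nat \<Rightarrow> real"
  where "affmap n A a x = (\<lambda>i. dotp n (A i) x + a i)"

definition max_affine ::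
  "nat \<Rightarrow> nat \<Rightarrow> nat \<Rightarrow>
   (nat \<Rightarrow> nat \<Rightarrow> nat \<Rightarrow> real) \<Rightarrow> (nat \<Rightarrow> nat \<Rightarrow> real) \<Rightarrow> (nat \<Rightarrow> nat \<Rightarrow> real) \<Rightarrow> (nat \<Rightarrow> real) \<Rightarrow>
   (nat \<Rightarrow> real) \<Rightarrow> (nat \<Rightarrow> real) \<Rightarrow> real"
  where "max_affine n m K A a B b x \<xi> =
    Max ((\<lambda>k. dotp m \<xi> (affmap n (A k) (a k) x) + (dotp n (B k) x + b k)) ` {1..K})"

text \<open>The infimum is a minimum, see \<open>G_fun_is_minimum\<close> below.\<close>

definition G_fun ::
  "nat \<Rightarrow> nat \<Rightarrow> nat \<Rightarrow>
   (nat \<Rightarrow> nat \<Rightarrow> nat \<Rightarrow> real) \<Rightarrow> (nat \<Rightarrow> nat \<Rightarrow> real) \<Rightarrow> (nat \<Rightarrow> nat \<Rightarrow> real) \<Rightarrow> (nat \<Rightarrow> real) \<Rightarrow>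
   real \<Rightarrow> (nat \<Rightarrow> real) \<Rightarrow> real \<Rightarrow> (nat \<Rightarrow> real) \<Rightarrow> real"
  where "G_fun n m K A a B b p \<xi>0 \<theta> x =
    (INF \<xi> \<in> pball m p \<xi>0 \<theta>. max_affine n m K A a B b x \<xi>)"

lemma compact_pball:
  assumes "p > 0"
  shows "compact (pball m p \<xi>0 \<theta>)"
proof -
  define C where "C = PiE UNIV (\<lambda>i. if i < m then {\<xi>0 i - \<theta> .. \<xi>0 i + \<theta>} else {0::real})"
  have "compactin (product_topology (\<lambda>i. euclidean) UNIV) C"
    unfolding C_def by (subst compactin_PiE) auto
  then have C: "compact C"
    by (simp add: euclidean_product_topology)
  have sub: "pball m p \<xi>0 \<theta> \<subseteq> C"
  proof
    fix \<xi> assume \<xi>: "\<xi> \<in> pball m p \<xi>0 \<theta>"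
    have "\<xi> i \<in> (if i < m then {\<xi>0 i - \<theta> .. \<xi>0 i + \<theta>} else {0})" for i
    proof (cases "i < m")
      case True
      have "\<bar>\<xi> i - \<xi>0 i\<bar> = (\<bar>\<xi> i - \<xi>0 i\<bar> powr p) powr (1/p)"
        using assms by (simp add: powr_powr)
      also have "\<dots> \<le> (\<Sum>j<m. \<bar>\<xi> j - \<xi>0 j\<bar> powr p) powr (1/p)"
        using assms True by (intro powr_mono2 member_le_sum) auto
      also have "\<dots> \<le> \<theta>"
        using \<xi> by (simp add: pball_def pnorm_def)
      finally show ?thesis using True by auto
    next
      case False
      then show ?thesis using \<xi> by (simp add: pball_def Rn_def)
    qed
    then show "\<xi> \<in> C" by (auto simp: C_def)
  qed
  have "closed (Rn m)"
  proof -
    have "Rn m = (\<Inter>i\<in>{m..}. {x. x i = 0})"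
      by (auto simp: Rn_def)
    moreover have "closed {x. x i = (0::real)}" for i :: nat
      by (intro closed_Collect_eq continuous_on_product_coordinates continuous_on_const)
    ultimately show ?thesis by (simp add: closed_INT)
  qed
  moreover have "closed {\<xi>. pnorm m p (\<xi> - \<xi>0) \<le> \<theta>}"
    unfolding pnorm_def minus_apply using assms
    by (intro closed_Collect_le continuous_intros continuous_on_powr'
        continuous_on_product_coordinates) (auto simp: sum_nonneg)
  ultimately have "closed (pball m p \<xi>0 \<theta>)"
    by (simp add: pball_def closed_Int Collect_conj_eq)
  then show ?thesis
    using C sub by (metis compact_Int_closed inf.absorb_iff2 inf.commute)
qed

lemma continuous_on_Max_image:
  fixes f :: "'k \<Rightarrow> 'a::topological_space \<Rightarrow> real"
  assumes "finite I" "I \<noteq> {}" "\<And>k. k \<in> I \<Longrightarrow> continuous_on S (f k)"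
  shows "continuous_on S (\<lambda>x. Max ((\<lambda>k. f k x) ` I))"
  using assms
proof (induction I rule: finite_ne_induct)
  case (insert k I)
  then have "continuous_on S (\<lambda>x. max (f k x) (Max ((\<lambda>k. f k x) ` I)))"
    by (intro continuous_on_max) auto
  with insert show ?case by simp
qed simp

lemma G_fun_is_minimum:
  assumes "p > 0" "\<theta> \<ge> 0" "\<xi>0 \<in> Rn m" "K \<ge> 1"
  shows "\<exists>\<xi>\<in>pball m p \<xi>0 \<theta>. G_fun n m K A a B b p \<xi>0 \<theta> x = max_affine n m K A a B b x \<xi> \<and>
    (\<forall>\<xi>'\<in>pball m p \<xi>0 \<theta>. max_affine n m K A a B b x \<xi> \<le> max_affine n m K A a B b x \<xi>')"
proof -
  have "\<xi>0 \<in> pball m p \<xi>0 \<theta>"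
    using assms by (simp add: pball_def pnorm_def)
  moreover have "continuous_on (pball m p \<xi>0 \<theta>) (max_affine n m K A a B b x)"
    unfolding max_affine_def using assms
    by (intro continuous_on_Max_image)
      (auto simp: dotp_def intro!: continuous_intros
        continuous_on_subset[OF continuous_on_product_coordinates])
  ultimately obtain \<xi> where \<xi>: "\<xi> \<in> pball m p \<xi>0 \<theta>"
    "\<forall>\<xi>'\<in>pball m p \<xi>0 \<theta>. max_affine n m K A a B b x \<xi> \<le> max_affine n m K A a B b x \<xi>'"
    using continuous_attains_inf[OF compact_pball] assms by blast
  then have "G_fun n m K A a B b p \<xi>0 \<theta> x = max_affine n m K A a B b x \<xi>"
    unfolding G_fun_def by (intro cInf_eq_minimum) auto
  with \<xi> show ?thesis by blast
qed

end

theory Submission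
  imports Defs
begin

text \<open>
  Among infinitely many points of an MICP-R set, two have integer witnesses of equal parity, so
  their midpoint lies in the set as well. This fails for the epigraph of the minimum of
  \<xi> \<bullet> x over the unit p-ball of the plane, which is minus the dual norm: by strict
  convexity of the q-th power, the points (x, -1) with x on the dual unit sphere in the positive
  quadrant have no midpoints in the epigraph.
\<close>

section \<open>Parity, midpoints and strict convexity\<close>

lemma add_half_in_Ints:
  fixes a b :: real
  assumes "a \<in> \<int>" "b \<in> \<int>" "a / 2 \<in> \<int> \<longleftrightarrow> b / 2 \<in> \<int>"
  shows "(a + b) / 2 \<in> \<int>"
\<comment> \<open>For an integer \<open>a\<close>, being even is expressed as
  \<open>a / 2 \<in> \<int>\<close>, since integer witnesses are real-valued here. Both even: the
  halves add up. Both odd: the sum is even.\<close>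
proof (cases "a / 2 \<in> \<int>")
  case True
  then show ?thesis
    using assms by (simp add: add_divide_distrib)
next
  case False
  obtain i j where ij: "a = of_int i" "b = of_int j"
    using assms by (auto elim!: Ints_cases)
  have half: "of_int k / 2 \<in> (\<int> :: real set)" if "even k" for k
    using that by (auto elim!: evenE)
  have "odd i" "odd j"
    using False assms(3) half ij by auto
  then show ?thesis
    using half[of "i + j"] ij by simp
qed

lemma MICP_R_midpoint:
  assumes "MICP_R n S" "T \<subseteq> S" "infinite T"
  obtains x y where "x \<in> T" "y \<in> T" "x \<noteq> y" "(1/2) *\<^sub>R x + (1/2) *\<^sub>R y \<in> S"
proof -
  from assms(1) obtain r d M where SR: "S \<subseteq> Rn n" and "convex M"
    and M: "\<And>x. x \<in> Rn n \<Longrightarrow> x \<in> S \<longleftrightarrow> (\<exists>y\<in>Rn r. \<exists>z\<in>Zn d. vappend n x (vappend r y z) \<in> M)"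
    unfolding MICP_R_def by blast
  have "\<forall>x\<in>T. \<exists>y z. y \<in> Rn r \<and> z \<in> Zn d \<and> vappend n x (vappend r y z) \<in> M"
    using M SR assms(2) by blast
  then obtain Y Z where YZ: "\<And>x. x \<in> T \<Longrightarrow> Y x \<in> Rn r" "\<And>x. x \<in> T \<Longrightarrow> Z x \<in> Zn d"
    "\<And>x. x \<in> T \<Longrightarrow> vappend n x (vappend r (Y x) (Z x)) \<in> M"
    by metis
  \<comment> \<open>\<open>P x\<close> is the set of even coordinates of the witness
    \<open>Z x\<close>. There are at most 2^d such patterns, so the infinite set \<open>T\<close>
    contains two distinct points sharing one.\<close>
  define P where "P x = {i\<in>{..<d}. Z x i / 2 \<in> \<int>}" for x
  have "finite (P ` T)"
    by (rule finite_subset[of _ "Pow {..<d}"]) (auto simp: P_def)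
  then have "\<not> inj_on P T"
    using assms(3) finite_imageD by blast
  then obtain x y where xy: "x \<in> T" "y \<in> T" "x \<noteq> y" "P x = P y"
    by (auto simp: inj_on_def)
  define mid where "mid = (\<lambda>u v :: nat \<Rightarrow> real. (1/2) *\<^sub>R u + (1/2) *\<^sub>R v)"
  have mid: "mid u v i = (u i + v i) / 2" for u v i
    by (simp add: mid_def scaleR_fun_def add_divide_distrib)
  have "mid (vappend n x (vappend r (Y x) (Z x))) (vappend n y (vappend r (Y y) (Z y))) \<in> M"
    unfolding mid_def using xy YZ by (intro convexD[OF \<open>convex M\<close>]) auto
  \<comment> \<open>Concatenation is coordinatewise, so it commutes with midpoints; the midpoint in
    \<open>M\<close> is thus a lift of \<open>mid x y\<close>.\<close>
  also have "mid (vappend n x (vappend r (Y x) (Z x))) (vappend n y (vappend r (Y y) (Z y)))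
      = vappend n (mid x y) (vappend r (mid (Y x) (Y y)) (mid (Z x) (Z y)))"
    by (auto simp: fun_eq_iff mid vappend_def)
  finally have "vappend n (mid x y) (vappend r (mid (Y x) (Y y)) (mid (Z x) (Z y))) \<in> M" .
  moreover have "mid (Y x) (Y y) \<in> Rn r"
    using YZ(1) xy by (simp add: Rn_def mid)
  moreover have "mid (Z x) (Z y) \<in> Zn d"
  proof -
    have "Z x i / 2 \<in> \<int> \<longleftrightarrow> Z y i / 2 \<in> \<int>" if "i < d" for i
      using xy(4) that by (auto simp: P_def)
    then show ?thesis
      using YZ(2)[OF xy(1)] YZ(2)[OF xy(2)] by (auto simp: Zn_def Rn_def mid intro: add_half_in_Ints)
  qed
  moreover have "mid x y \<in> Rn n"
  proof -
    have "x \<in> Rn n" "y \<in> Rn n"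
      using SR assms(2) xy by auto
    then show ?thesis
      by (simp add: Rn_def mid)
  qed
  ultimately have "mid x y \<in> S"
    using M by blast
  then show thesis
    using that xy by (simp add: mid_def)
qed

text \<open>The derivative of t^q is strictly increasing for q > 1. By the mean value theorem on
  each half of the interval, the growth over the right half exceeds that over the left half.\<close>

lemma powr_strict_midpoint_convex:
  fixes x y q :: real
  assumes "1 < q" "0 < x" "0 < y" "x \<noteq> y"
  shows "((x + y) / 2) powr q < (x powr q + y powr q) / 2"
  using assms(2-)
proof (induction x y rule: linorder_wlog)
  case (le x y)
  define m where "m = (x + y) / 2"
  have m: "x < m" "m < y" "m - x = y - m"
    using le by (auto simp: m_def field_simps)
  have D: "((\<lambda>t. t powr q) has_real_derivative q * t powr (q - 1)) (at t)" if "0 < t" for t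
    using that by (rule has_real_derivative_powr)
  obtain c where c: "x < c" "c < m" "m powr q - x powr q = (m - x) * (q * c powr (q - 1))"
    using MVT2[of x m "\<lambda>t. t powr q" "\<lambda>t. q * t powr (q - 1)"] D m le by force
  obtain c' where c': "m < c'" "c' < y" "y powr q - m powr q = (y - m) * (q * c' powr (q - 1))"
    using MVT2[of m y "\<lambda>t. t powr q" "\<lambda>t. q * t powr (q - 1)"] D m le by force
  have "c powr (q - 1) < c' powr (q - 1)"
    using c c' le assms(1) by (intro powr_less_mono2) auto
  then have "(m - x) * (q * c powr (q - 1)) < (m - x) * (q * c' powr (q - 1))"
    using m assms(1) by simp
  then have "m powr q - x powr q < y powr q - m powr q"
    using c(3) c'(3) m(3) by simp
  then show ?case
    by (simp add: m_def)
next
  case (sym x y)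
  then show ?case
    by (simp add: add.commute)
qed

section \<open>The unit box as domain\<close>

definition unit_box :: "nat \<Rightarrow> (nat \<Rightarrow> real) set"
  where "unit_box n = {x \<in> Rn n. \<forall>i<n. 0 \<le> x i \<and> x i \<le> 1}"

lemma convex_unit_box: "convex (unit_box n)"
  unfolding convex_def
  by (auto simp: unit_box_def Rn_def scaleR_fun_def intro: convex_bound_le)

lemma compact_unit_box: "compact (unit_box n)"
proof -
  \<comment> \<open>The factors \<open>{0}\<close> beyond index n make the box a product of compact
    sets over all indices, so Tychonoff's theorem applies.\<close>
  have "unit_box n = PiE UNIV (\<lambda>i. if i < n then {0..1} else {0})"
  proof -
    have "x \<in> unit_box n \<longleftrightarrow> (\<forall>i. x i \<in> (if i < n then {0..1} else {0}))" for x
      by (auto simp: unit_box_def Rn_def not_less)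
    then show ?thesis
      by (auto simp: PiE_iff)
  qed
  moreover have "compactin (product_topology (\<lambda>i. euclidean) UNIV) \<dots>"
    by (subst compactin_PiE) auto
  ultimately show ?thesis
    by (simp add: euclidean_product_topology)
qed

lemma rel_interior_unit_box: "rel_interior (unit_box n) \<noteq> {}"
proof -
  define c :: "nat \<Rightarrow> real" where "c = (\<lambda>i. if i < n then 1/2 else 0)"
  \<comment> \<open>\<open>U\<close> restricts only finitely many coordinates, hence is open in the
    product topology. The remaining coordinates vanish on the affine hull of the box.\<close>
  define U :: "(nat \<Rightarrow> real) set" where "U = (\<Inter>i<n. {x. 0 < x i} \<inter> {x. x i < 1})"
  have "open {x :: nat \<Rightarrow> real. 0 < x i}" "open {x :: nat \<Rightarrow> real. x i < 1}" for i
    by (intro open_Collect_less continuous_on_product_coordinates continuous_on_const)+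
  then have "open U"
    unfolding U_def by (intro open_INT open_Int finite_lessThan ballI)
  have "affine (Rn n)"
    by (auto simp: affine_def Rn_def scaleR_fun_def)
  then have hull: "affine hull unit_box n \<subseteq> Rn n"
    by (intro hull_minimal) (auto simp: unit_box_def)
  have "c \<in> unit_box n"
    by (auto simp: c_def unit_box_def Rn_def)
  moreover have "c \<in> U"
    by (auto simp: c_def U_def)
  moreover have "U \<inter> affine hull unit_box n \<subseteq> unit_box n"
  proof
    fix x assume x: "x \<in> U \<inter> affine hull unit_box n"
    then have "x \<in> Rn n" "\<forall>i<n. 0 < x i \<and> x i < 1"
      using hull by (auto simp: U_def)
    then show "x \<in> unit_box n"
      by (auto simp: unit_box_def less_imp_le)
  qed
  ultimately have "c \<in> rel_interior (unit_box n)"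
    using \<open>open U\<close> hull_subset[of "unit_box n" affine]
    by (auto simp: rel_interior)
  then show ?thesis
    by blast
qed

section \<open>The objective as a bilinear form\<close>

definition unit_coef :: "nat \<Rightarrow> nat \<Rightarrow> nat \<Rightarrow> real"
  where "unit_coef k i j = (if i = j then 1 else 0)"

text \<open>Each \<open>unit_coef k\<close> is the identity matrix, and for K = 1 the maximum has a
  single term.\<close>

lemma max_affine_unit_coef:
  "max_affine n n 1 unit_coef (\<lambda>_ _. 0) (\<lambda>_ _. 0) (\<lambda>_. 0) x \<xi> = dotp n \<xi> x"
proof -
  have "dotp n (unit_coef 1 i) x = x i" if "i < n" for i
    using that by (simp add: dotp_def unit_coef_def of_bool_def[symmetric])
  then show ?thesis
    by (simp add: max_affine_def affmap_def) (simp add: dotp_def)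
qed

abbreviation min_dotp :: "real \<Rightarrow> (nat \<Rightarrow> real) \<Rightarrow> real"
  where "min_dotp p \<equiv> G_fun 2 2 1 unit_coef (\<lambda>_ _. 0) (\<lambda>_ _. 0) (\<lambda>_. 0) p 0 1"

lemma lessThan_2: "{..<2} = {0, 1 :: nat}"
  by auto

lemma unit_pball_2_iff:
  assumes "1 < p"
  shows "\<xi> \<in> pball 2 p 0 1 \<longleftrightarrow> \<xi> \<in> Rn 2 \<and> \<bar>\<xi> 0\<bar> powr p + \<bar>\<xi> 1\<bar> powr p \<le> 1"
proof -
  have "s powr (1 / p) \<le> 1 \<longleftrightarrow> s \<le> 1" if "0 \<le> s" for s
    using that assms powr_le1[of "1/p" s] powr_le1[of p "s powr (1/p)"] by (auto simp: powr_powr)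
  then show ?thesis
    by (simp add: pball_def pnorm_def lessThan_2)
qed

section \<open>Conjugate exponents: values on and inside the q-sphere\<close>

context
  fixes p q :: real
  assumes p: "1 < p" and q: "1 < q" and pq: "1 / p + 1 / q = 1"
begin

lemma min_dotp_le:
  assumes "0 \<le> u" "u \<le> 1" "x 0 = u powr (1/q)" "x 1 = (1 - u) powr (1/q)"
  shows "min_dotp p x \<le> -1"
proof -
  \<comment> \<open>The equality case of Hoelder's inequality, with negative sign: in each
    coordinate \<open>\<bar>\<xi> i\<bar> powr p\<close> equals \<open>x i powr q\<close>.\<close>
  define \<xi> :: "nat \<Rightarrow> real"
    where "\<xi> = (\<lambda>i. if i = 0 then - (u powr (1/p)) else if i = 1 then - ((1 - u) powr (1/p)) else 0)"
  have "\<xi> \<in> pball 2 p 0 1"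
    using assms p by (simp add: unit_pball_2_iff \<xi>_def Rn_def powr_powr)
  then have "min_dotp p x \<le> dotp 2 \<xi> x"
    using G_fun_is_minimum[of p 1 0 2 1 2 unit_coef "\<lambda>_ _. 0" "\<lambda>_ _. 0" "\<lambda>_. 0" x] p
    by (auto simp: max_affine_unit_coef Rn_def simp del: One_nat_def)
  also have "\<dots> = - (u powr (1/p + 1/q)) - (1 - u) powr (1/p + 1/q)"
    using assms(3,4) by (simp add: dotp_def lessThan_2 \<xi>_def powr_add)
  also have "\<dots> = -1"
    using assms by (simp add: pq)
  finally show ?thesis .
qed

text \<open>Young's inequality in each coordinate bounds \<open>- dotp 2 \<xi> x\<close> strictly
  below 1/p + 1/q = 1. Since the infimum is attained, the strict bound at a minimiser passes to the
  minimum.\<close>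

lemma min_dotp_greater:
  assumes "0 \<le> x 0" "0 \<le> x 1" "x 0 powr q + x 1 powr q < 1"
  shows "-1 < min_dotp p x"
proof -
  obtain \<xi> where \<xi>: "\<xi> \<in> pball 2 p 0 1" "min_dotp p x = dotp 2 \<xi> x"
    using G_fun_is_minimum[of p 1 0 2 1 2 unit_coef "\<lambda>_ _. 0" "\<lambda>_ _. 0" "\<lambda>_. 0" x] p
    by (auto simp: max_affine_unit_coef Rn_def simp del: One_nat_def)
  have Y: "- (\<xi> i * x i) \<le> \<bar>\<xi> i\<bar> powr p / p + x i powr q / q" if "0 \<le> x i" for i
  proof -
    have "- (\<xi> i * x i) \<le> \<bar>\<xi> i\<bar> * x i"
      using that by (metis abs_ge_minus_self abs_mult abs_of_nonneg)
    also have "\<dots> \<le> \<bar>\<xi> i\<bar> powr p / p + x i powr q / q"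
      using Youngs_inequality p q pq that by simp
    finally show ?thesis .
  qed
  have "- dotp 2 \<xi> x \<le> (\<bar>\<xi> 0\<bar> powr p + \<bar>\<xi> 1\<bar> powr p) / p + (x 0 powr q + x 1 powr q) / q"
    using Y[of 0] Y[of 1] assms by (simp add: dotp_def lessThan_2 add_divide_distrib)
  also have "\<dots> < 1 / p + 1 / q"
    using \<xi>(1) assms p q by (intro add_le_less_mono divide_right_mono divide_strict_right_mono)
      (auto simp: unit_pball_2_iff)
  finally show ?thesis
    using \<xi>(2) pq by simp
qed

lemma not_MICP_R_epigraph_min_dotp:
  "\<not> MICP_R 3 (epigraph_on 2 (unit_box 2) (min_dotp p))"
proof
  \<comment> \<open>\<open>w u\<close> runs along the q-sphere in the positive quadrant; u is the
    q-th power of its first coordinate.\<close>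
  define w :: "real \<Rightarrow> nat \<Rightarrow> real" where
    "w u = (\<lambda>i. if i = 0 then u powr (1/q) else if i = 1 then (1 - u) powr (1/q) else 0)" for u
  let ?E = "epigraph_on 2 (unit_box 2) (min_dotp p)"
  \<comment> \<open>The open interval keeps both coordinates of \<open>w u\<close> positive, as
    strict convexity will require. The entry at index 2 is the epigraph height.\<close>
  define T where "T = (\<lambda>u. (w u)(2 := -1)) ` {0<..<1}"
  assume "MICP_R 3 ?E"
  moreover have "T \<subseteq> ?E"
  proof -
    have "w u \<in> unit_box 2" "min_dotp p (w u) \<le> -1" if "u \<in> {0<..<1}" for u
      using that q min_dotp_le[of u "w u"]
      by (auto simp: w_def unit_box_def Rn_def powr_le1)
    then show ?thesis
      unfolding T_def epigraph_on_def by blast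
  qed
  moreover have "infinite T"
  proof -
    have "inj_on (\<lambda>u. (w u)(2 := -1)) {0<..<1}"
    proof (rule inj_onI)
      fix u v :: real
      assume "u \<in> {0<..<1}" "v \<in> {0<..<1}" and eq: "(w u)(2 := -1) = (w v)(2 := -1)"
      have "u powr (1/q) = v powr (1/q)"
        using fun_cong[OF eq, of 0] by (simp add: w_def)
      then have "(u powr (1/q)) powr q = (v powr (1/q)) powr q"
        by simp
      then show "u = v"
        using q \<open>u \<in> _\<close> \<open>v \<in> _\<close> by (simp add: powr_powr)
    qed
    then show ?thesis
      unfolding T_def by (simp add: finite_image_iff)
  qed
  ultimately obtain y z where yz: "y \<in> T" "z \<in> T" "y \<noteq> z" "(1/2) *\<^sub>R y + (1/2) *\<^sub>R z \<in> ?E"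
    by (rule MICP_R_midpoint)
  then obtain u v where uv: "u \<in> {0<..<1}" "v \<in> {0<..<1}" "u \<noteq> v"
    "(1/2) *\<^sub>R (w u)(2 := -1) + (1/2) *\<^sub>R (w v)(2 := -1) \<in> ?E"
    unfolding T_def by blast
  then obtain x t where xt: "(1/2) *\<^sub>R (w u)(2 := -1) + (1/2) *\<^sub>R (w v)(2 := -1) = x(2 := t)"
    "min_dotp p x \<le> t"
    by (auto simp: epigraph_on_def)
  have x: "x 0 = (u powr (1/q) + v powr (1/q)) / 2"
    "x 1 = ((1 - u) powr (1/q) + (1 - v) powr (1/q)) / 2" "t = -1"
    using fun_cong[OF xt(1), of 0] fun_cong[OF xt(1), of 1] fun_cong[OF xt(1), of 2]
    by (simp_all add: w_def scaleR_fun_def field_simps)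
  \<comment> \<open>Strict midpoint convexity of t^q, applied to the q-th roots of r and s.\<close>
  have strict: "((r powr (1/q) + s powr (1/q)) / 2) powr q < (r + s) / 2"
    if "0 < r" "0 < s" "r \<noteq> s" for r s :: real
  proof -
    have cancel: "(r powr (1/q)) powr q = r" if "0 < r" for r :: real
      using that q by (simp add: powr_powr)
    then have "r powr (1/q) \<noteq> s powr (1/q)"
      using that by metis
    then show ?thesis
      using powr_strict_midpoint_convex[of q "r powr (1/q)" "s powr (1/q)"] that q cancel by simp
  qed
  \<comment> \<open>The right-hand side is 1, so the midpoint lies strictly inside the q-ball. Its
    value therefore exceeds -1, while its height is still -1.\<close>
  have "x 0 powr q + x 1 powr q < (u + v) / 2 + ((1 - u) + (1 - v)) / 2"
    unfolding x using uv by (intro add_strict_mono strict) auto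
  then have "-1 < min_dotp p x"
    by (intro min_dotp_greater) (simp_all add: x add_divide_distrib [symmetric] del: One_nat_def)
  then show False
    using xt(2) x(3) by simp
qed

end

theorem proposition4:
  fixes p :: real
  assumes "1 < p"
  shows "\<exists>(n::nat) (m::nat) (K::nat) (X :: (nat \<Rightarrow> real) set)
      (A :: nat \<Rightarrow> nat \<Rightarrow> nat \<Rightarrow> real) (a :: nat \<Rightarrow> nat \<Rightarrow> real)
      (B :: nat \<Rightarrow> nat \<Rightarrow> real) (b :: nat \<Rightarrow> real) (\<xi>0 :: nat \<Rightarrow> real) (\<theta> :: real).
    1 \<le> n \<and> 1 \<le> m \<and> 1 \<le> K \<and>
    X \<subseteq> Rn n \<and> compact X \<and> convex X \<and> rel_interior X \<noteq> {} \<and>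
    \<xi>0 \<in> Rn m \<and> 0 \<le> \<theta> \<and>
    \<not> MICP_R_fun n X (G_fun n m K A a B b p \<xi>0 \<theta>)"
proof -
  \<comment> \<open>The exponent conjugate to p; it is finite and greater than 1 because p >
    1.\<close>
  define q where "q = p / (p - 1)"
  have "1 < q" "1 / p + 1 / q = 1"
    using assms by (auto simp: q_def field_simps)
  then have "\<not> MICP_R_fun 2 (unit_box 2) (min_dotp p)"
    using not_MICP_R_epigraph_min_dotp[OF assms] by (simp add: MICP_R_fun_def)
  moreover have "unit_box 2 \<subseteq> Rn 2"
    by (auto simp: unit_box_def)
  moreover have "0 \<in> Rn 2"
    by (simp add: Rn_def)
  ultimately have "(1::nat) \<le> 2 \<and> (1::nat) \<le> 2 \<and> (1::nat) \<le> 1 \<and>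
      unit_box 2 \<subseteq> Rn 2 \<and> compact (unit_box 2) \<and> convex (unit_box 2) \<and>
      rel_interior (unit_box 2) \<noteq> {} \<and> 0 \<in> Rn 2 \<and> (0::real) \<le> 1 \<and>
      \<not> MICP_R_fun 2 (unit_box 2) (min_dotp p)"
    using compact_unit_box convex_unit_box rel_interior_unit_box by simp
  then show ?thesis
    by blast
qed

end
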